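(* Let $\Sigma$ be an extended tight span in $\mathbb{R}^d$, that is, a polytopal complex whose vertices are a finite point configuration $P\subset\mathbb{R}^d$ and which covers the convex hull of $P$. Let $V$ be a subset of the vertices of $\Sigma$. Provided the facets and the boundary faces of $\Sigma$ in their vertex description, the algorithm FaceIterator visits exactly once all faces of $\Sigma$ not containing any vertex of $V$.
   Context: Facets of $\Sigma$ are its maximal cells; boundary faces are the faces on the boundary of $\Sigma$; faces are identified with their vertex sets. The complex $\Sigma$ can be embedded into a closed $d$-manifold $M$: in any case one can add a vertex $\infty$ at infinity and, for each face $F$ on the boundary of $\Sigma$, a face $F\cup\{\infty\}$; in many cases just adding one facet containing all vertices on the boundary works as well. The algorithm is applied to the face poset of $M$ with an artificial upper bound added, using its options of ignored sets (no face contained in one of them is visited) and ignored atoms (no face containing one of them is visited). For instance, given a collection $\Gamma$ of boundary faces of $\Sigma$, the iteration over all elements of $\Sigma$ having empty intersection with $\Gamma$ is described as iterating over all faces of $M$ which do not contain a vertex of $\Gamma$ and are not contained in a facet in $M\setminus\Sigma$. "Visits" means "outputs". Algorithm FaceIterator$(C,I,J)$, where, for the finite set $X$ of vertices of $M$, $I$ is a list of subsets of $X$ (ignored sets), $J\subseteq X$ (ignored atoms), and $C$ is the list of coatoms (facets of $M$, as vertex sets) not contained in any element of $I$. If $C$ is empty, stop. Otherwise: 1. Let $a$ be the first element of $C$. 2. If $a\cap J=\emptyset$, output $a$. 3. Let $N_1=\{a\cap b : b\in C,\ b\neq a\}$, let $N_2=\{x\in N_1 : x\not\subseteq y \text{ for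 all } y\in I\}$, and let $N$ be the list (without repetitions) of inclusion-maximal elements of $N_2$. 4. Call FaceIterator$(N, I, J)$ with a copy of $I$ (so that later changes made to $I$ inside this call do not affect the current $I$). 5. Let $C'=\{x\in C : x\not\subseteq a\cup J\}$ and append $a\cup J$ to $I$. 6. Call FaceIterator$(C', I, J)$. *)

theory Defs
  imports "HOL-Analysis.Analysis" "HOL-Library.Monad_Syntax"
begin

text \<open>
  The algorithm, returning the list of output faces in the order of output; \<open>None\<close> stands for
  nontermination. Step 3 does not say in which order the new list is arranged, so this is left to
  a parameter \<open>arr\<close>, which turns a list into a list without repetitions having the same elements.
\<close>

partial_function (option) face_iterator ::
  "('v set list \<Rightarrow> 'v set list) \<Rightarrow> 'v set list \<Rightarrow> 'v set list \<Rightarrow> 'v set \<Rightarrow> 'v set list option"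
where
  "face_iterator arr C I J =
    (case C of
      [] \<Rightarrow> Some []
    | a # _ \<Rightarrow>
        (let out = (if a \<inter> J = {} then [a] else []);
             N1 = map (\<lambda>b. a \<inter> b) (filter (\<lambda>b. b \<noteq> a) C);
             N2 = filter (\<lambda>x. \<forall>y\<in>set I. \<not> x \<subseteq> y) N1;
             N = arr (filter (\<lambda>x. \<forall>y\<in>set N2. \<not> x \<subset> y) N2);
             C' = filter (\<lambda>x. \<not> x \<subseteq> a \<union> J) C
         in do {
           below \<leftarrow> face_iterator arr N I J;
           rest \<leftarrow> face_iterator arr C' (I @ [a \<union> J]) J;
           Some (out @ below @ rest)
         }))"

definition arranges :: "('b list \<Rightarrow> 'b list) \<Rightarrow> bool" where
  "arranges arr \<longleftrightarrow> (\<forall>xs. distinct (arr xs) \<and> set (arr xs) = set xs)"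

definition visits_exactly_once ::
  "('v set list \<Rightarrow> 'v set list) \<Rightarrow> 'v set list \<Rightarrow> 'v set list \<Rightarrow> 'v set \<Rightarrow> 'v set set \<Rightarrow> bool"
where
  "visits_exactly_once arr C I J \<F> \<longleftrightarrow>
    (\<exists>out. face_iterator arr C I J = Some out \<and> distinct out \<and> set out = \<F>)"

definition polytopal_complex :: "'a::euclidean_space set set \<Rightarrow> bool" where
  "polytopal_complex \<Sigma> \<longleftrightarrow>
    finite \<Sigma> \<and>
    (\<forall>S\<in>\<Sigma>. polytope S) \<and>
    (\<forall>S\<in>\<Sigma>. \<forall>F. F face_of S \<longrightarrow> F \<in> \<Sigma>) \<and>
    (\<forall>S\<in>\<Sigma>. \<forall>T\<in>\<Sigma>. (S \<inter> T) face_of S \<and> (S \<inter> T) face_of T)"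

definition extended_tight_span :: "'a::euclidean_space set set \<Rightarrow> 'a set \<Rightarrow> bool" where
  "extended_tight_span \<Sigma> P \<longleftrightarrow>
    finite P \<and> P \<noteq> {} \<and>
    polytopal_complex \<Sigma> \<and>
    {v. {v} \<in> \<Sigma>} = P \<and>
    \<Union>\<Sigma> = convex hull P"

definition vertices_of :: "'a::real_vector set \<Rightarrow> 'a set" where
  "vertices_of F = {v. v extreme_point_of F}"

text \<open>
  The relative frontier is the frontier if \<open>\<Sigma>\<close> is full-dimensional. The empty face is always
  a boundary face of \<open>\<Sigma>\<close>; it accounts for the vertex at infinity of the closed manifold.
\<close>

definition boundary_faces :: "'a::euclidean_space set set \<Rightarrow> 'a set set" where
  "boundary_faces \<Sigma> = {F \<in> \<Sigma>. F \<subseteq> rel_frontier (\<Union>\<Sigma>)}"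

text \<open>
  Vertex sets in the closed manifold \<open>M\<close>: the point at infinity is \<open>None\<close>, and a vertex
  \<open>v\<close> of \<open>\<Sigma>\<close> is \<open>Some v\<close>.
\<close>

definition vertex_set :: "'a::real_vector set \<Rightarrow> 'a option set" where
  "vertex_set F = Some ` vertices_of F"

definition closed_manifold :: "'a::euclidean_space set set \<Rightarrow> 'a option set set" where
  "closed_manifold \<Sigma> =
    vertex_set ` \<Sigma> \<union> (\<lambda>F. insert None (vertex_set F)) ` boundary_faces \<Sigma>"

definition coatoms :: "'v set set \<Rightarrow> 'v set set" where
  "coatoms M = {A \<in> M. \<forall>B\<in>M. \<not> A \<subset> B}"

text \<open>The facets of \<open>M\<close> that are not in \<open>\<Sigma>\<close>.\<close>

definition outer_facets :: "'a::euclidean_space set set \<Rightarrow> 'a option set set" where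
  "outer_facets \<Sigma> = coatoms (closed_manifold \<Sigma>) - vertex_set ` \<Sigma>"

end

theory Submission
  imports Defs
begin

text \<open>
  The face poset of \<open>M\<close>, with \<open>UNIV\<close> as artificial upper bound, is locally branched: whenever
  \<open>x < a < t\<close>, some \<open>z\<close> with \<open>x \<le> z < t\<close> does not lie below \<open>a\<close>. Hence a coatom of \<open>a\<close> that lies in
  no ignored set is the intersection of \<open>a\<close> with another coatom of \<open>t\<close>, which lies in no ignored
  set either; so the recursive calls receive exactly the coatoms they need, and induction on
  \<open>t\<close> and on the number of remaining coatoms applies.

  Below a proper face of \<open>M\<close>, branching holds because a proper face of a polytope is the
  intersection of the facets containing it. For \<open>t = UNIV\<close> it is a local argument at a relative
  interior point \<open>p\<close> of the face \<open>x\<close>: the cells containing \<open>x\<close> cover a neighbourhood of \<open>p\<close> in the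
  convex hull, or, for boundary faces, in its relative frontier; if they were all contained in
  \<open>a\<close>, then \<open>p\<close> would lie in the relative interior of \<open>a\<close>.
\<close>

section \<open>The iterator on a locally branched family of sets\<close>

abbreviation below :: "'v set set \<Rightarrow> 'v set \<Rightarrow> 'v set set" where
  "below L t \<equiv> {x \<in> L. x \<subset> t}"

definition avoiding :: "'v set set \<Rightarrow> 'v set set \<Rightarrow> 'v set set" where
  "avoiding A Y = {x \<in> A. \<forall>y\<in>Y. \<not> x \<subseteq> y}"

text \<open>
  In a finite family this is equivalent to the condition that every interval of length two has
  at least two inner elements.
\<close>

definition locally_branched :: "'v set set \<Rightarrow> bool" where
  "locally_branched L \<longleftrightarrow>
    (\<forall>x\<in>L. \<forall>a\<in>L. \<forall>t\<in>L. x \<subset> a \<longrightarrow> a \<subset> t \<longrightarrow> (\<exists>z\<in>L. x \<subseteq> z \<and> z \<subset> t \<and> \<not> z \<subseteq> a))"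

lemma coatom_above:
  assumes "finite A" "x \<in> A"
  obtains c where "c \<in> coatoms A" "x \<subseteq> c"
  using finite_has_maximal2[OF assms] unfolding coatoms_def by blast

text \<open>Distinct coatoms of \<open>t\<close> are incomparable, so every set in \<open>N\<close>
  lies strictly below \<open>a\<close>. Conversely, for a coatom \<open>x\<close> of
  \<open>a\<close>, branching gives \<open>z\<close> above \<open>x\<close> but not below
  \<open>a\<close>; for a coatom \<open>b\<close> of \<open>t\<close> above \<open>z\<close>,
  maximality of \<open>x\<close> forces \<open>a \<inter> b = x\<close>.\<close>

lemma coatoms_from_intersections:
  assumes fin: "finite L" and int: "\<And>x y. x \<in> L \<Longrightarrow> y \<in> L \<Longrightarrow> x \<inter> y \<in> L"
    and branched: "locally_branched L" and "t \<in> L"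
    and C: "C = avoiding (coatoms (below L t)) Y" and "a \<in> C"
    and N: "N = avoiding ((\<inter>) a ` (C - {a})) Y"
  shows "coatoms N = avoiding (coatoms (below L a)) Y"
proof -
  have a: "a \<in> L" "a \<subset> t"
    using \<open>a \<in> C\<close> by (auto simp: C avoiding_def coatoms_def)
  have N_below: "x \<in> below L a" if x: "x \<in> N" for x
  proof -
    obtain b where b: "x = a \<inter> b" "b \<in> C" "b \<noteq> a"
      using x by (auto simp: N avoiding_def)
    then have "\<not> a \<subseteq> b"
      using \<open>a \<in> C\<close> by (auto simp: C avoiding_def coatoms_def)
    then show ?thesis
      using b a int by (auto simp: C avoiding_def coatoms_def)
  qed
  have in_N: "x \<in> N" if x: "x \<in> avoiding (coatoms (below L a)) Y" for x
  proof -
    have xL: "x \<in> L" "x \<subset> a" and xY: "\<forall>y\<in>Y. \<not> x \<subseteq> y"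
      using x by (auto simp: avoiding_def coatoms_def)
    obtain z where z: "z \<in> L" "x \<subseteq> z" "z \<subset> t" "\<not> z \<subseteq> a"
      using branched xL a \<open>t \<in> L\<close> unfolding locally_branched_def by meson
    obtain b where b: "b \<in> coatoms (below L t)" "z \<subseteq> b"
      using coatom_above[of "below L t" z] fin z by auto
    have "x \<subseteq> b" using z b by blast
    \<comment> \<open>A set containing \<open>x\<close> lies in no ignored set, since
      \<open>x\<close> lies in none.\<close>
    then have "\<forall>y\<in>Y. \<not> b \<subseteq> y" using xY by blast
    then have "b \<in> C" using b by (simp add: C avoiding_def)
    moreover have "b \<noteq> a" using b z by blast
    moreover have "a \<inter> b = x"
    proof -
      have "a \<inter> b \<in> below L a"
        using int a b z \<open>a \<in> C\<close> by (auto simp: C avoiding_def coatoms_def)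
      moreover have "x \<subseteq> a \<inter> b" using xL b z by auto
      ultimately show ?thesis using x by (auto simp: avoiding_def coatoms_def)
    qed
    ultimately show ?thesis using xY by (auto simp: N avoiding_def)
  qed
  show ?thesis
  proof (rule set_eqI, rule iffI)
    fix x assume x: "x \<in> coatoms N"
    then have xN: "x \<in> N" by (simp add: coatoms_def)
    obtain c where c: "c \<in> coatoms (below L a)" "x \<subseteq> c"
      using coatom_above[OF _ N_below[OF xN]] fin by auto
    have "c \<in> avoiding (coatoms (below L a)) Y"
      using c xN by (auto simp: avoiding_def N)
    with in_N[OF this] x c show "x \<in> avoiding (coatoms (below L a)) Y"
      by (auto simp: coatoms_def)
  next
    fix x assume x: "x \<in> avoiding (coatoms (below L a)) Y"
    then show "x \<in> coatoms N"
      using in_N[OF x] N_below by (auto simp: coatoms_def avoiding_def)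
  qed
qed

text \<open>The invariant on \<open>C\<close> is kept by both calls: the call on \<open>N\<close>
  replaces \<open>t\<close> by the smaller \<open>a\<close> (outer induction), the call on
  \<open>C'\<close> keeps \<open>t\<close> and shortens the list (inner induction).\<close>

lemma face_iterator_visits_exactly_once:
  assumes fin: "finite L" and int: "\<And>x y. x \<in> L \<Longrightarrow> y \<in> L \<Longrightarrow> x \<inter> y \<in> L"
    and branched: "locally_branched L" and arr: "arranges arr"
    and "t \<in> L" and "set C = avoiding (coatoms (below L t)) (set I)"
  shows "visits_exactly_once arr C I J {x \<in> avoiding (below L t) (set I). x \<inter> J = {}}"
  using assms(5,6)
proof (induction "card (below L t)" arbitrary: t C I rule: less_induct)
  case less
  note lower = less.hyps
  show ?case
    using less.prems
  proof (induction "length C" arbitrary: C I rule: less_induct)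
    case less
    note t = \<open>t \<in> L\<close> and C = less.prems(2)
    show ?case
    proof (cases C)
      case Nil
      have "avoiding (below L t) (set I) = {}"
      proof -
        have False if x: "x \<in> avoiding (below L t) (set I)" for x
        proof -
          obtain c where "c \<in> coatoms (below L t)" "x \<subseteq> c"
            using coatom_above[of "below L t" x] x fin by (auto simp: avoiding_def)
          moreover have "\<forall>y\<in>set I. \<not> x \<subseteq> y"
            using x by (simp add: avoiding_def)
          ultimately have "c \<in> set C"
            by (simp add: C avoiding_def) blast
          then show False using Nil by simp
        qed
        then show ?thesis by blast
      qed
      then show ?thesis
        by (simp add: visits_exactly_once_def Nil face_iterator.simps)
    next
      case (Cons a Cs)
      then have aC: "a \<in> set C" by simp
      then have a: "a \<in> L" "a \<subset> t" "\<forall>y\<in>set I. \<not> a \<subseteq> y"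
        by (auto simp: C avoiding_def coatoms_def)
      define N2 where
        "N2 = filter (\<lambda>x. \<forall>y\<in>set I. \<not> x \<subseteq> y) (map (\<lambda>b. a \<inter> b) (filter (\<lambda>b. b \<noteq> a) C))"
      define N where "N = arr (filter (\<lambda>x. \<forall>y\<in>set N2. \<not> x \<subset> y) N2)"
      define C' where "C' = filter (\<lambda>x. \<not> x \<subseteq> a \<union> J) C"
      have N2: "set N2 = avoiding ((\<inter>) a ` (set C - {a})) (set I)"
        by (auto simp: N2_def avoiding_def)
      have "set N = coatoms (set N2)"
        using arr by (auto simp: N_def arranges_def coatoms_def)
      also have "\<dots> = avoiding (coatoms (below L a)) (set I)"
        by (rule coatoms_from_intersections[OF fin int branched t C aC N2])
      finally have N: "set N = avoiding (coatoms (below L a)) (set I)" .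
      have C': "set C' = avoiding (coatoms (below L t)) (set (I @ [a \<union> J]))"
        by (auto simp: C'_def C avoiding_def)
      have "below L a \<subset> below L t" using a by auto
      then have "card (below L a) < card (below L t)"
        by (intro psubset_card_mono) (use fin in auto)
      from lower[OF this \<open>a \<in> L\<close> N] obtain out1 where
        out1: "face_iterator arr N I J = Some out1" "distinct out1"
          "set out1 = {x \<in> avoiding (below L a) (set I). x \<inter> J = {}}"
        by (auto simp: visits_exactly_once_def)
      have "length C' < length C"
        unfolding C'_def using aC by (intro length_filter_less) auto
      from less.hyps[OF this t C'] obtain out2 where
        out2: "face_iterator arr C' (I @ [a \<union> J]) J = Some out2" "distinct out2"
          "set out2 = {x \<in> avoiding (below L t) (set (I @ [a \<union> J])). x \<inter> J = {}}"
        by (auto simp: visits_exactly_once_def)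
      define out where "out = (if a \<inter> J = {} then [a] else []) @ out1 @ out2"
      have "face_iterator arr C I J = Some out"
        by (subst face_iterator.simps)
          (use out1(1) out2(1) Cons in \<open>simp add: Let_def out_def N_def N2_def C'_def\<close>)
      moreover have "distinct out"
      proof -
        have "a \<notin> set out1" by (simp add: out1(3) avoiding_def)
        moreover have "a \<notin> set out2" by (simp add: out2(3) avoiding_def)
        \<comment> \<open>The first call outputs only sets below \<open>a\<close>, and the second
          one ignores \<open>a \<union> J\<close>.\<close>
        moreover have "x \<notin> set out2" if "x \<in> set out1" for x
        proof -
          have "x \<subset> a" using that by (simp add: out1(3) avoiding_def)
          then have "x \<subseteq> a \<union> J" by blast
          then show ?thesis by (simp add: out2(3) avoiding_def)
        qed
        ultimately show ?thesis using out1(2) out2(2) unfolding out_def by auto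
      qed
      moreover have "set out = {x \<in> avoiding (below L t) (set I). x \<inter> J = {}}"
      proof (rule set_eqI)
        fix x
        show "x \<in> set out \<longleftrightarrow> x \<in> {x \<in> avoiding (below L t) (set I). x \<inter> J = {}}"
        proof (cases "x \<inter> J = {}")
          case True
          \<comment> \<open>For a set disjoint from \<open>J\<close>, ignoring
            \<open>a \<union> J\<close> amounts to ignoring \<open>a\<close>. So what is to be
            visited splits into \<open>a\<close>, the sets strictly below \<open>a\<close>, and
            those not below \<open>a\<close>.\<close>
          then have "x \<subseteq> a \<union> J \<longleftrightarrow> x = a \<or> x \<subset> a" by blast
          moreover have "x \<subset> t" if "x \<subset> a" using that \<open>a \<subset> t\<close> by (rule psubset_trans)
          ultimately have "x \<in> avoiding (below L t) (set I) \<longleftrightarrow>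
              x = a \<or> x \<in> avoiding (below L a) (set I) \<or>
              x \<in> avoiding (below L t) (set (I @ [a \<union> J]))"
            using a by (simp add: avoiding_def) metis
          with True show ?thesis
            unfolding out_def set_append Un_iff out1(3) out2(3) by (cases "x = a") simp_all
        next
          case False
          then show ?thesis by (auto simp: out_def out1(3) out2(3))
        qed
      qed
      ultimately show ?thesis unfolding visits_exactly_once_def by blast
    qed
  qed
qed

section \<open>Faces of polytopes\<close>

lemma convex_hull_vertices_of:
  fixes F :: "'a::euclidean_space set"
  shows "polytope F \<Longrightarrow> convex hull (vertices_of F) = F"
  unfolding vertices_of_def
  using Krein_Milman_Minkowski[of F] by (simp add: polytope_imp_compact polytope_imp_convex)

lemma polytope_subset_if_vertices_subset:
  fixes F :: "'a::euclidean_space set"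
  assumes "polytope F" "convex A" "vertices_of F \<subseteq> A"
  shows "F \<subseteq> A"
  using hull_minimal[of "vertices_of F" A convex] convex_hull_vertices_of[OF assms(1)] assms(2,3)
  by simp

text \<open>If every proper face of \<open>T\<close> containing \<open>X\<close> lay in
  \<open>A\<close>, every facet containing \<open>X\<close> would be \<open>A\<close> for reasons of
  dimension. A nonempty \<open>X\<close> is the intersection of these facets, so it would contain
  \<open>A\<close>. For empty \<open>X\<close>, a vertex of \<open>T\<close> outside
  \<open>A\<close> serves.\<close>

lemma polytope_face_lattice_branched:
  fixes T :: "'a::euclidean_space set"
  assumes T: "polytope T" and X: "X face_of T" and A: "A face_of T" and "X \<subset> A" "A \<noteq> T"
  shows "\<exists>Z. Z face_of T \<and> Z \<noteq> T \<and> X \<subseteq> Z \<and> \<not> Z \<subseteq> A"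
proof (cases "X = {}")
  case True
  have "A \<subset> T" using A \<open>A \<noteq> T\<close> face_of_imp_subset by auto
  have "\<not> vertices_of T \<subseteq> A"
    using polytope_subset_if_vertices_subset[OF T face_of_imp_convex[OF A]] \<open>A \<subset> T\<close> by blast
  then obtain v where "{v} face_of T" "v \<notin> A"
    by (auto simp: vertices_of_def face_of_singleton)
  moreover have "{v} \<noteq> T" using \<open>A \<subset> T\<close> \<open>X \<subset> A\<close> \<open>v \<notin> A\<close> by auto
  ultimately show ?thesis using True by blast
next
  case False
  show ?thesis
  proof (rule ccontr)
    assume "\<not> ?thesis"
    then have no: "\<And>Z. Z face_of T \<Longrightarrow> Z \<noteq> T \<Longrightarrow> X \<subseteq> Z \<Longrightarrow> Z \<subseteq> A"
      by blast
    have dimA: "aff_dim A < aff_dim T"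
      using face_of_aff_dim_lt[OF polytope_imp_convex[OF T] A \<open>A \<noteq> T\<close>] .
    have "h = A" if h: "h facet_of T" "X \<subseteq> h" for h
    proof (rule ccontr)
      assume "h \<noteq> A"
      have "h face_of T" "aff_dim h = aff_dim T - 1" using h by (auto simp: facet_of_def)
      then have "h \<subseteq> A" using no h by fastforce
      then have "h face_of A"
        using \<open>h face_of T\<close> face_of_subset face_of_imp_subset[OF A] by blast
      then have "aff_dim h < aff_dim A"
        using face_of_aff_dim_lt[OF face_of_imp_convex[OF A]] \<open>h \<noteq> A\<close> by blast
      then show False using dimA \<open>aff_dim h = aff_dim T - 1\<close> by auto
    qed
    moreover have "X = \<Inter>{F. F facet_of T \<and> X \<subseteq> F}"
      using face_of_polyhedron[OF polytope_imp_polyhedron[OF T] X False] \<open>X \<subset> A\<close> \<open>A \<noteq> T\<close>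
        face_of_imp_subset[OF A] by auto
    ultimately have "A \<subseteq> X" by blast
    then show False using \<open>X \<subset> A\<close> by auto
  qed
qed

text \<open>A relative interior point of \<open>A\<close> lies in some proper face of
  \<open>K\<close>, and a face meeting the relative interior of a convex subset contains that
  subset.\<close>

lemma polytope_convex_subset_rel_frontier:
  fixes K :: "'a::euclidean_space set"
  assumes K: "polytope K" and A: "convex A" "A \<noteq> {}" "A \<subseteq> rel_frontier K"
  obtains H where "H face_of K" "H \<noteq> K" "A \<subseteq> H"
proof -
  obtain r where r: "r \<in> rel_interior A"
    using A rel_interior_eq_empty by blast
  then have "r \<in> rel_frontier K"
    using A rel_interior_subset by blast
  then obtain H where H: "H face_of K" "H \<noteq> K" "r \<in> H"
    using rel_frontier_of_polyhedron_alt[OF polytope_imp_polyhedron[OF K]] by auto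
  have "A \<subseteq> K"
    using A polytope_imp_closed[OF K] by (auto simp: rel_frontier_def)
  then show ?thesis
    using subset_of_face_of[OF H(1), of A] r H that by auto
qed

lemma meets_rel_interior:
  fixes S :: "'a::euclidean_space set"
  assumes "convex S" "p \<in> S" "e > 0"
  obtains q where "q \<in> rel_interior S" "q \<in> ball p e"
proof -
  have "p \<in> closure (rel_interior S)"
    using convex_closure_rel_interior[OF assms(1)] closure_subset assms(2) by blast
  then obtain q where "q \<in> rel_interior S" "dist q p < e"
    using \<open>e > 0\<close> unfolding closure_approachable by blast
  then show ?thesis using that by (simp add: dist_commute)
qed

section \<open>Polytopal complexes covering a polytope\<close>

locale tight_span =
  fixes \<Sigma> :: "'a::euclidean_space set set" and P :: "'a set"
  assumes span: "extended_tight_span \<Sigma> P"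
begin

abbreviation "K \<equiv> \<Union>\<Sigma>"

lemma complex: "polytopal_complex \<Sigma>"
  and P: "finite P" "P \<noteq> {}" "{v. {v} \<in> \<Sigma>} = P"
  and K_hull: "K = convex hull P"
  using span by (auto simp: extended_tight_span_def)

lemma finite_complex: "finite \<Sigma>"
  and polytope_cell: "S \<in> \<Sigma> \<Longrightarrow> polytope S"
  and face_in_complex: "S \<in> \<Sigma> \<Longrightarrow> F face_of S \<Longrightarrow> F \<in> \<Sigma>"
  and Int_face: "S \<in> \<Sigma> \<Longrightarrow> T \<in> \<Sigma> \<Longrightarrow> S \<inter> T face_of S"
  using complex unfolding polytopal_complex_def by blast+

lemma Int_in_complex: "S \<in> \<Sigma> \<Longrightarrow> T \<in> \<Sigma> \<Longrightarrow> S \<inter> T \<in> \<Sigma>"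
  using Int_face face_in_complex by blast

lemma subset_imp_face: "S \<in> \<Sigma> \<Longrightarrow> T \<in> \<Sigma> \<Longrightarrow> S \<subseteq> T \<Longrightarrow> S face_of T"
  using Int_face[of T S] by (simp add: inf.absorb2)

lemma convex_cell: "S \<in> \<Sigma> \<Longrightarrow> convex S"
  by (simp add: polytope_cell polytope_imp_convex)

lemma polytope_K: "polytope K"
  using P by (simp add: K_hull polytope_convex_hull)

lemma K_nonempty: "K \<noteq> {}"
  using P by (simp add: K_hull)

lemma convex_K: "convex K"
  using polytope_K polytope_imp_convex by blast

lemma closed_K: "closed K"
  using polytope_K polytope_imp_closed by blast

lemma rel_frontier_K: "rel_frontier K = K - rel_interior K"
  using closed_K by (simp add: rel_frontier_def)

section \<open>Local structure at a relative interior point of a cell\<close>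

text \<open>The finitely many cells missing \<open>p\<close> have a closed union, so some ball
  around \<open>p\<close> avoids them. A cell \<open>S\<close> meeting the ball contains
  \<open>p\<close>, and the face \<open>X \<inter> S\<close> of \<open>X\<close>, having a relative
  interior point of \<open>X\<close>, is all of \<open>X\<close>.\<close>

lemma locally_in_star:
  assumes X: "X \<in> \<Sigma>" and p: "p \<in> rel_interior X"
  obtains e where "e > 0" "\<And>S. S \<in> \<Sigma> \<Longrightarrow> ball p e \<inter> S \<noteq> {} \<Longrightarrow> X \<subseteq> S"
proof -
  have "closed (\<Union>{S \<in> \<Sigma>. p \<notin> S})"
    using finite_complex polytope_cell polytope_imp_closed by (intro closed_Union) auto
  then have "open (- \<Union>{S \<in> \<Sigma>. p \<notin> S})" by (rule open_Compl)
  moreover have "p \<in> - \<Union>{S \<in> \<Sigma>. p \<notin> S}" by blast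
  ultimately obtain e where e: "e > 0" "ball p e \<subseteq> - \<Union>{S \<in> \<Sigma>. p \<notin> S}"
    by (rule openE)
  have "X \<subseteq> S" if S: "S \<in> \<Sigma>" "ball p e \<inter> S \<noteq> {}" for S
  proof -
    have "p \<in> S" using S e by blast
    then have "X \<subseteq> X \<inter> S"
      using subset_of_face_of[OF Int_face[OF X S(1)], of X] p rel_interior_subset by blast
    then show ?thesis by auto
  qed
  then show ?thesis using that e by blast
qed

text \<open>Otherwise \<open>p\<close> would be a relative interior point of \<open>A\<close>, but
  these avoid every proper face. Both local branching arguments end in this contradiction.\<close>

lemma proper_face_not_full:
  assumes "X \<in> \<Sigma>" "A \<in> \<Sigma>" "X \<subset> A" "p \<in> X" "d > 0"
  shows "\<not> ball p d \<inter> affine hull A \<subseteq> A"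
proof
  assume "ball p d \<inter> affine hull A \<subseteq> A"
  then have "p \<in> rel_interior A"
    using assms unfolding mem_rel_interior_ball by blast
  moreover have "X \<inter> rel_interior A = {}"
    using face_of_disjoint_rel_interior[OF subset_imp_face[of X A]] assms by blast
  ultimately show False using \<open>p \<in> X\<close> by blast
qed

text \<open>Near a relative interior point \<open>p\<close> of \<open>X\<close> in
  \<open>rel_interior K\<close>, the cells containing \<open>X\<close> fill
  \<open>affine hull K\<close>. If they all lay in \<open>A\<close>, then \<open>A\<close> would
  fill its affine hull near \<open>p\<close>.\<close>

lemma interior_face_branched:
  assumes X: "X \<in> \<Sigma>" and A: "A \<in> \<Sigma>" and "X \<subset> A" and "\<not> X \<subseteq> rel_frontier K"
  shows "\<exists>Z\<in>\<Sigma>. X \<subseteq> Z \<and> \<not> Z \<subseteq> A"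
proof (rule ccontr)
  assume "\<not> ?thesis"
  then have no: "\<And>Z. Z \<in> \<Sigma> \<Longrightarrow> X \<subseteq> Z \<Longrightarrow> Z \<subseteq> A" by blast
  \<comment> \<open>The relative frontier is closed: if it contained \<open>rel_interior X\<close>,
    it would contain \<open>X\<close>.\<close>
  have "X \<subseteq> closure (rel_interior X)"
    using convex_closure_rel_interior[OF convex_cell[OF X]] closure_subset by auto
  then have "\<not> rel_interior X \<subseteq> rel_frontier K"
    using closure_minimal[of "rel_interior X" "rel_frontier K"] assms(4) by auto
  then obtain p where p: "p \<in> rel_interior X" "p \<notin> rel_frontier K" by auto
  then have "p \<in> X" using rel_interior_subset by auto
  then have "p \<in> rel_interior K" using p X rel_frontier_K by auto
  then obtain e1 where e1: "e1 > 0" "ball p e1 \<inter> affine hull K \<subseteq> K"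
    by (auto simp: mem_rel_interior_ball)
  obtain e2 where e2: "e2 > 0" "\<And>S. S \<in> \<Sigma> \<Longrightarrow> ball p e2 \<inter> S \<noteq> {} \<Longrightarrow> X \<subseteq> S"
    using locally_in_star[OF X p(1)] by blast
  have "affine hull A \<subseteq> affine hull K" using A by (intro hull_mono) auto
  have "ball p (min e1 e2) \<inter> affine hull A \<subseteq> A"
  proof
    fix q assume q: "q \<in> ball p (min e1 e2) \<inter> affine hull A"
    then have "q \<in> ball p e1" "q \<in> ball p e2" by simp_all
    then obtain S where S: "S \<in> \<Sigma>" "q \<in> S"
      using q e1(2) \<open>affine hull A \<subseteq> affine hull K\<close> by blast
    then have "X \<subseteq> S" using e2(2)[OF S(1)] \<open>q \<in> ball p e2\<close> by blast
    then show "q \<in> A" using no S by blast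
  qed
  then show False
    using proper_face_not_full[OF X A \<open>X \<subset> A\<close> \<open>p \<in> X\<close>, of "min e1 e2"] e1 e2 by auto
qed

text \<open>Points of \<open>rel_interior K\<close> come arbitrarily close to a relative interior
  point \<open>p\<close> of \<open>A\<close>; a cell through one close enough contains
  \<open>A\<close>. The empty cell has no such \<open>p\<close> and is treated apart.\<close>

lemma in_cell_not_in_rel_frontier:
  assumes A: "A \<in> \<Sigma>"
  obtains Z where "Z \<in> \<Sigma>" "A \<subseteq> Z" "\<not> Z \<subseteq> rel_frontier K"
proof (cases "A = {}")
  case True
  obtain q where "q \<in> rel_interior K"
    using K_nonempty convex_K rel_interior_eq_empty by blast
  moreover then obtain S where "S \<in> \<Sigma>" "q \<in> S" using rel_interior_subset by blast
  ultimately show ?thesis using that True rel_frontier_K by blast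
next
  case False
  then obtain p where p: "p \<in> rel_interior A"
    using convex_cell[OF A] rel_interior_eq_empty by blast
  obtain e where e: "e > 0" "\<And>S. S \<in> \<Sigma> \<Longrightarrow> ball p e \<inter> S \<noteq> {} \<Longrightarrow> A \<subseteq> S"
    using locally_in_star[OF A p] by blast
  have "p \<in> K" using A p rel_interior_subset by blast
  then obtain q where q: "q \<in> rel_interior K" "q \<in> ball p e"
    using meets_rel_interior[OF convex_K _ e(1)] by blast
  obtain S where S: "S \<in> \<Sigma>" "q \<in> S" using q rel_interior_subset by blast
  then have "A \<subseteq> S" using e q by blast
  then show ?thesis using that S q rel_frontier_K by blast
qed

text \<open>The cell \<open>A\<close> lies in a proper face \<open>H\<close> of \<open>K\<close>. If
  all boundary cells above a nonempty \<open>X\<close> lay in \<open>A\<close>, so would the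
  relative frontier near a relative interior point \<open>p\<close> of \<open>X\<close>. This puts
  \<open>p\<close> in \<open>rel_interior H\<close>, and then \<open>A\<close> would fill its affine
  hull near \<open>p\<close>.\<close>

lemma boundary_face_branched:
  assumes X: "X \<in> \<Sigma>" and A: "A \<in> boundary_faces \<Sigma>" and "X \<subset> A"
  shows "\<exists>Z\<in>boundary_faces \<Sigma>. X \<subseteq> Z \<and> \<not> Z \<subseteq> A"
proof (rule ccontr)
  assume "\<not> ?thesis"
  then have no: "\<And>Z. Z \<in> \<Sigma> \<Longrightarrow> Z \<subseteq> rel_frontier K \<Longrightarrow> X \<subseteq> Z \<Longrightarrow> Z \<subseteq> A"
    by (auto simp: boundary_faces_def)
  have A\<Sigma>: "A \<in> \<Sigma>" and AK: "A \<subseteq> rel_frontier K" using A by (auto simp: boundary_faces_def)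
  obtain H where H: "H face_of K" "H \<noteq> K" "A \<subseteq> H"
    using polytope_convex_subset_rel_frontier[OF polytope_K convex_cell[OF A\<Sigma>] _ AK] \<open>X \<subset> A\<close> by blast
  have HK: "H \<subseteq> rel_frontier K" using face_of_subset_rel_frontier H by blast
  show False
  proof (cases "X = {}")
    case True
    \<comment> \<open>For empty \<open>X\<close> the witness is a vertex of \<open>K\<close> outside
      \<open>H\<close>, taken from a proper face \<open>Z\<close> not contained in
      \<open>H\<close>.\<close>
    obtain Z where Z: "Z face_of K" "Z \<noteq> K" "\<not> Z \<subseteq> H"
      using polytope_face_lattice_branched[OF polytope_K empty_face_of H(1)] \<open>X \<subset> A\<close> H by blast
    have "\<not> vertices_of Z \<subseteq> H"
      using polytope_subset_if_vertices_subset[OF face_of_polytope_polytope[OF polytope_K Z(1)]]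
        face_of_imp_convex[OF H(1)] Z(3) by blast
    then obtain v where v: "v extreme_point_of Z" "v \<notin> H" by (auto simp: vertices_of_def)
    then have "v extreme_point_of K" "v \<in> Z" using extreme_point_of_face[OF Z(1)] by auto
    then have "v \<in> P" using extreme_point_of_convex_hull K_hull by metis
    then have "{v} \<in> \<Sigma>" using P by auto
    moreover have "v \<in> rel_frontier K" using face_of_subset_rel_frontier Z \<open>v \<in> Z\<close> by blast
    ultimately show False using no[of "{v}"] True v H by auto
  next
    case False
    then obtain p where p: "p \<in> rel_interior X"
      using convex_cell[OF X] rel_interior_eq_empty by blast
    then have "p \<in> X" using rel_interior_subset by auto
    obtain e where e: "e > 0" "\<And>S. S \<in> \<Sigma> \<Longrightarrow> ball p e \<inter> S \<noteq> {} \<Longrightarrow> X \<subseteq> S"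
      using locally_in_star[OF X p] by blast
    have near: "q \<in> A" if q: "q \<in> ball p e" "q \<in> rel_frontier K" for q
    proof -
      obtain S where S: "S \<in> \<Sigma>" "q \<in> S" using q rel_frontier_K by auto
      obtain G where G: "G face_of K" "G \<noteq> K" "q \<in> G"
        using rel_frontier_of_polyhedron_alt[OF polytope_imp_polyhedron[OF polytope_K]] q by auto
      \<comment> \<open>A proper face of \<open>K\<close> cuts out of the cell \<open>S\<close> a
        face of \<open>S\<close>, hence a boundary cell.\<close>
      have "G \<inter> S face_of K \<inter> S" using face_of_slice[OF G(1) convex_cell[OF S(1)]] .
      moreover have "K \<inter> S = S" using S by auto
      ultimately have GS: "G \<inter> S \<in> \<Sigma>" using face_in_complex S by auto
      then have "X \<subseteq> G \<inter> S" using e(2)[OF GS] S G q by blast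
      then show ?thesis
        using no[OF GS] face_of_subset_rel_frontier[OF G(1,2)] S G by blast
    qed
    \<comment> \<open>Otherwise a second proper face of \<open>K\<close> through \<open>p\<close> would leave \<open>A\<close> arbitrarily close to \<open>p\<close>.\<close>
    have "p \<in> rel_interior H"
    proof (rule ccontr)
      assume "p \<notin> rel_interior H"
      have polyH: "polytope H" using face_of_polytope_polytope[OF polytope_K H(1)] .
      have "p \<in> closure H" using \<open>p \<in> X\<close> \<open>X \<subset> A\<close> H(3) closure_subset by blast
      then have "p \<in> rel_frontier H"
        using \<open>p \<notin> rel_interior H\<close> by (simp add: rel_frontier_def)
      then obtain G where G: "G face_of H" "G \<noteq> H" "p \<in> G"
        using rel_frontier_of_polyhedron_alt[OF polytope_imp_polyhedron[OF polyH]] by auto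
      have "G \<subset> H" using G face_of_imp_subset by auto
      obtain Z where Z: "Z face_of K" "Z \<noteq> K" "G \<subseteq> Z" "\<not> Z \<subseteq> H"
        using polytope_face_lattice_branched[OF polytope_K face_of_trans[OF G(1) H(1)] H(1) \<open>G \<subset> H\<close> H(2)]
        by blast
      obtain q where q: "q \<in> rel_interior Z" "q \<in> ball p e"
        using meets_rel_interior[OF face_of_imp_convex[OF Z(1)] _ e(1), of p] Z G by blast
      have "q \<in> Z" using q rel_interior_subset by blast
      then have "q \<in> H" using near q face_of_subset_rel_frontier[OF Z(1,2)] H by blast
      \<comment> \<open>\<open>H\<close> contains the relative interior point \<open>q\<close> of
        \<open>Z\<close>, so it would contain all of \<open>Z\<close>.\<close>
      then show False
        using subset_of_face_of[OF H(1) face_of_imp_subset[OF Z(1)]] q Z by blast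
    qed
    then obtain e1 where e1: "e1 > 0" "ball p e1 \<inter> affine hull H \<subseteq> H"
      by (auto simp: mem_rel_interior_ball)
    have "affine hull A \<subseteq> affine hull H" using H by (intro hull_mono)
    have "ball p (min e e1) \<inter> affine hull A \<subseteq> A"
    proof
      fix q assume q: "q \<in> ball p (min e e1) \<inter> affine hull A"
      then have "q \<in> ball p e" "q \<in> ball p e1" by simp_all
      then show "q \<in> A"
        using q e1(2) near[of q] HK \<open>affine hull A \<subseteq> affine hull H\<close> by blast
    qed
    then show False
      using proper_face_not_full[OF X A\<Sigma> \<open>X \<subset> A\<close> \<open>p \<in> X\<close>, of "min e e1"] e e1 by auto
  qed
qed

section \<open>The closed manifold\<close>

abbreviation "M \<equiv> closed_manifold \<Sigma>"

abbreviation vertex_set_at_infinity :: "'a set \<Rightarrow> 'a option set" where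
  "vertex_set_at_infinity F \<equiv> insert None (vertex_set F)"

lemma None_notin_vertex_set: "None \<notin> vertex_set F"
  by (auto simp: vertex_set_def)

lemma vertex_set_subset_iff:
  assumes "F \<in> \<Sigma>" "G \<in> \<Sigma>"
  shows "vertex_set F \<subseteq> vertex_set G \<longleftrightarrow> F \<subseteq> G"
proof
  assume "vertex_set F \<subseteq> vertex_set G"
  then have "vertices_of F \<subseteq> vertices_of G" by (auto simp: vertex_set_def)
  then show "F \<subseteq> G"
    using hull_mono[of "vertices_of F" "vertices_of G" convex] polytope_cell assms
    by (simp add: convex_hull_vertices_of)
next
  assume "F \<subseteq> G"
  then show "vertex_set F \<subseteq> vertex_set G"
    using extreme_point_of_face[OF subset_imp_face[OF assms]]
    by (auto simp: vertex_set_def vertices_of_def)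
qed

text \<open>Reduces inclusions between faces of the manifold, with or without \<open>None\<close>,
  to inclusions between cells.\<close>

lemmas manifold_order_simps =
  less_le_not_le vertex_set_subset_iff None_notin_vertex_set subset_insert

lemma vertex_set_Int:
  assumes "F \<in> \<Sigma>" "G \<in> \<Sigma>"
  shows "vertex_set F \<inter> vertex_set G = vertex_set (F \<inter> G)"
proof -
  have "v \<in> vertices_of (F \<inter> G) \<longleftrightarrow> v \<in> vertices_of F \<and> v \<in> vertices_of G" for v
  proof -
    have "v extreme_point_of (F \<inter> G) \<longleftrightarrow> v extreme_point_of F \<and> v \<in> F \<inter> G"
      using extreme_point_of_face[OF Int_face[OF assms]] .
    moreover have "v extreme_point_of (G \<inter> F) \<longleftrightarrow> v extreme_point_of G \<and> v \<in> G \<inter> F"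
      using extreme_point_of_face[OF Int_face[OF assms(2,1)]] .
    moreover have "v extreme_point_of F \<Longrightarrow> v \<in> F" "v extreme_point_of G \<Longrightarrow> v \<in> G"
      by (simp_all add: extreme_point_of_def)
    ultimately show ?thesis
      unfolding vertices_of_def mem_Collect_eq Int_commute[of G F] Int_iff by argo
  qed
  then show ?thesis by (auto simp: vertex_set_def)
qed

lemma boundary_face_subset:
  "F \<in> \<Sigma> \<Longrightarrow> G \<in> boundary_faces \<Sigma> \<Longrightarrow> F \<subseteq> G \<Longrightarrow> F \<in> boundary_faces \<Sigma>"
  by (auto simp: boundary_faces_def)

lemma boundary_face_in_complex: "F \<in> boundary_faces \<Sigma> \<Longrightarrow> F \<in> \<Sigma>"
  by (simp add: boundary_faces_def)

lemma manifold_cases: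
  assumes "x \<in> M"
  obtains F where "F \<in> \<Sigma>" "x = vertex_set F"
  | F where "F \<in> boundary_faces \<Sigma>" "x = vertex_set_at_infinity F"
  using assms by (auto simp: closed_manifold_def)

lemma vertex_set_in_manifold: "F \<in> \<Sigma> \<Longrightarrow> vertex_set F \<in> M"
  and infinity_in_manifold: "F \<in> boundary_faces \<Sigma> \<Longrightarrow> vertex_set_at_infinity F \<in> M"
  by (auto simp: closed_manifold_def)

lemma finite_manifold: "finite M"
  using finite_complex by (simp add: closed_manifold_def boundary_faces_def)

lemma finite_in_manifold:
  assumes "x \<in> M" shows "finite x"
proof -
  have "finite (vertex_set F)" if "F \<in> \<Sigma>" for F
    using finite_polyhedron_extreme_points[OF polytope_imp_polyhedron[OF polytope_cell[OF that]]]
    by (simp add: vertex_set_def vertices_of_def)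
  then show ?thesis
    using assms by (auto elim!: manifold_cases simp: boundary_faces_def)
qed

text \<open>A Euclidean space is unbounded, hence infinite, while faces have finitely many vertices.
  Thus \<open>UNIV\<close> can serve as the artificial upper bound.\<close>

lemma psubset_UNIV:
  assumes "x \<in> M" shows "x \<subset> UNIV"
proof -
  have "infinite (UNIV :: 'a option set)"
    using finite_imp_bounded[of "UNIV :: 'a set"] not_bounded_UNIV
    by (auto simp: UNIV_option_conv finite_image_iff)
  then have "x \<noteq> UNIV" using finite_in_manifold[OF assms] by metis
  then show ?thesis by blast
qed

text \<open>\<open>None\<close> survives only if both faces contain it; their cells then meet in a
  boundary face again.\<close>

lemma Int_in_manifold:
  assumes "x \<in> M" "y \<in> M"
  shows "x \<inter> y \<in> M"
  using assms(1)
proof (cases rule: manifold_cases)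
  case x: (1 F)
  show ?thesis
    using assms(2)
  proof (cases rule: manifold_cases)
    case (1 G)
    then show ?thesis
      using x vertex_set_Int vertex_set_in_manifold Int_in_complex by metis
  next
    case (2 G)
    then have "x \<inter> y = vertex_set (F \<inter> G)"
      using x vertex_set_Int[of F G] None_notin_vertex_set by (auto simp: boundary_faces_def)
    then show ?thesis
      using x 2 vertex_set_in_manifold Int_in_complex boundary_face_in_complex by metis
  qed
next
  case x: (2 F)
  show ?thesis
    using assms(2)
  proof (cases rule: manifold_cases)
    case (1 G)
    then have "x \<inter> y = vertex_set (F \<inter> G)"
      using x vertex_set_Int[of F G] None_notin_vertex_set by (auto simp: boundary_faces_def)
    then show ?thesis
      using x 1 vertex_set_in_manifold Int_in_complex boundary_face_in_complex by metis
  next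
    case (2 G)
    then have "x \<inter> y = vertex_set_at_infinity (F \<inter> G)"
      using x vertex_set_Int[of F G] by (auto simp: boundary_faces_def)
    moreover have "F \<inter> G \<in> boundary_faces \<Sigma>"
      using x 2 Int_in_complex by (auto simp: boundary_faces_def)
    ultimately show ?thesis using infinity_in_manifold by metis
  qed
qed

section \<open>Branching in the intervals of the manifold\<close>

lemma cell_interval_branched:
  assumes "X \<in> \<Sigma>" "A \<in> \<Sigma>" and T: "T \<in> \<Sigma>" and "X \<subset> A" "A \<subset> T"
  shows "\<exists>Z\<in>\<Sigma>. X \<subseteq> Z \<and> Z \<subset> T \<and> \<not> Z \<subseteq> A"
proof -
  have "X face_of T" "A face_of T" "A \<noteq> T"
    using assms subset_imp_face[of X T] subset_imp_face[of A T] by blast+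
  then obtain Z where Z: "Z face_of T" "Z \<noteq> T" "X \<subseteq> Z" "\<not> Z \<subseteq> A"
    using polytope_face_lattice_branched[OF polytope_cell[OF T] _ _ \<open>X \<subset> A\<close>] by blast
  then have "Z \<in> \<Sigma>" "Z \<subset> T"
    using face_in_complex[OF T] face_of_imp_subset[of Z T] by blast+
  then show ?thesis using Z by blast
qed

lemma branched_under_cell:
  assumes "x \<in> M" "a \<in> M" and T: "T \<in> \<Sigma>" and xa: "x \<subset> a" and aT: "a \<subset> vertex_set T"
  shows "\<exists>z\<in>M. x \<subseteq> z \<and> z \<subset> vertex_set T \<and> \<not> z \<subseteq> a"
proof -
  have "None \<notin> x" "None \<notin> a" using xa aT None_notin_vertex_set[of T] by blast+
  then obtain X A where XA: "X \<in> \<Sigma>" "x = vertex_set X" "A \<in> \<Sigma>" "a = vertex_set A"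
    using assms(1,2) by (elim manifold_cases) auto
  have "X \<subset> A" "A \<subset> T" using xa aT XA T by (simp_all add: manifold_order_simps)
  then obtain Z where Z: "Z \<in> \<Sigma>" "X \<subseteq> Z" "Z \<subset> T" "\<not> Z \<subseteq> A"
    using cell_interval_branched[OF XA(1,3) T] by blast
  show ?thesis
    using XA T Z by (intro bexI[OF _ vertex_set_in_manifold[OF Z(1)]])
      (simp add: manifold_order_simps)
qed

text \<open>If \<open>a\<close> omits \<open>None\<close>, the witness is \<open>x\<close> with
  \<open>None\<close> added. If \<open>a\<close> contains \<open>None\<close> but \<open>x\<close>
  does not, it is the vertex set of \<open>H\<close>. If both contain it, branching among the faces
  of \<open>H\<close> gives a cell to which \<open>None\<close> is added.\<close>

lemma branched_under_infinity:
  assumes "x \<in> M" "a \<in> M" and H: "H \<in> boundary_faces \<Sigma>" and xa: "x \<subset> a"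
    and aH: "a \<subset> vertex_set_at_infinity H"
  shows "\<exists>z\<in>M. x \<subseteq> z \<and> z \<subset> vertex_set_at_infinity H \<and> \<not> z \<subseteq> a"
  using \<open>a \<in> M\<close>
proof (cases rule: manifold_cases)
  case A: (1 A)
  note H' = boundary_face_in_complex[OF H]
  have "None \<notin> x" using xa A(2) None_notin_vertex_set[of A] by blast
  then obtain X where X: "X \<in> \<Sigma>" "x = vertex_set X"
    using assms(1) by (elim manifold_cases) auto
  have "X \<subset> A" "A \<subseteq> H" using xa aH X A H' by (simp_all add: manifold_order_simps)
  then have "X \<subset> H" by blast
  have X': "X \<in> boundary_faces \<Sigma>"
    using boundary_face_subset[OF X(1) H] \<open>X \<subset> H\<close> by blast
  show ?thesis
    using X A H' \<open>X \<subset> H\<close> by (intro bexI[OF _ infinity_in_manifold[OF X']])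
      (auto simp: manifold_order_simps)
next
  case A: (2 A)
  note A' = boundary_face_in_complex[OF A(1)] and H' = boundary_face_in_complex[OF H]
  have "A \<subset> H" using A(2) aH A' H' by (simp add: manifold_order_simps)
  show ?thesis
    using \<open>x \<in> M\<close>
  proof (cases rule: manifold_cases)
    case X: (1 X)
    have "X \<subseteq> A" using xa X A(2) A' by (simp add: manifold_order_simps)
    then have "X \<subseteq> H" using \<open>A \<subset> H\<close> by blast
    then show ?thesis
      using X A(2) A' H' \<open>A \<subset> H\<close> by (intro bexI[OF _ vertex_set_in_manifold[OF H']])
        (simp add: manifold_order_simps)
  next
    case X: (2 X)
    note X' = boundary_face_in_complex[OF X(1)]
    have "X \<subset> A" using X(2) A(2) xa X' A' by (simp add: manifold_order_simps)
    then obtain Z where Z: "Z \<in> \<Sigma>" "X \<subseteq> Z" "Z \<subset> H" "\<not> Z \<subseteq> A"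
      using cell_interval_branched[OF X' A' H' _ \<open>A \<subset> H\<close>] by blast
    have Z': "Z \<in> boundary_faces \<Sigma>"
      using boundary_face_subset[OF Z(1) H] Z(3) by blast
    show ?thesis
      using X(2) A(2) X' A' H' Z by (intro bexI[OF _ infinity_in_manifold[OF Z']])
        (simp add: manifold_order_simps subset_insertI2)
  qed
qed

text \<open>If \<open>a\<close> omits \<open>None\<close>, a boundary face \<open>X\<close> is
  extended by \<open>None\<close>, and any other \<open>X\<close> branches inside \<Sigma>. If
  \<open>a\<close> contains \<open>None\<close> but \<open>x\<close> does not, the witness is a cell
  above \<open>A\<close> off the boundary. If both contain it, the boundary faces branch.\<close>

lemma branched_at_top:
  assumes "x \<in> M" "a \<in> M" and xa: "x \<subset> a"
  shows "\<exists>z\<in>M. x \<subseteq> z \<and> \<not> z \<subseteq> a"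
  using \<open>a \<in> M\<close>
proof (cases rule: manifold_cases)
  case A: (1 A)
  have "None \<notin> x" using xa A(2) None_notin_vertex_set[of A] by blast
  then obtain X where X: "X \<in> \<Sigma>" "x = vertex_set X"
    using assms(1) by (elim manifold_cases) auto
  show ?thesis
  proof (cases "X \<in> boundary_faces \<Sigma>")
    case True
    show ?thesis
      using X A by (intro bexI[OF _ infinity_in_manifold[OF True]])
        (simp add: manifold_order_simps)
  next
    case False
    have "X \<subset> A" using X A xa by (simp add: manifold_order_simps)
    moreover have "\<not> X \<subseteq> rel_frontier K" using False X(1) by (simp add: boundary_faces_def)
    ultimately obtain Z where Z: "Z \<in> \<Sigma>" "X \<subseteq> Z" "\<not> Z \<subseteq> A"
      using interior_face_branched[OF X(1) A(1)] by blast
    show ?thesis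
      using X A Z by (intro bexI[OF _ vertex_set_in_manifold[OF Z(1)]])
        (simp add: manifold_order_simps)
  qed
next
  case A: (2 A)
  note A' = boundary_face_in_complex[OF A(1)]
  show ?thesis
    using \<open>x \<in> M\<close>
  proof (cases rule: manifold_cases)
    case X: (1 X)
    obtain Z where Z: "Z \<in> \<Sigma>" "A \<subseteq> Z" "\<not> Z \<subseteq> rel_frontier K"
      using in_cell_not_in_rel_frontier[OF A'] by blast
    have "A \<subseteq> rel_frontier K" using A(1) by (simp add: boundary_faces_def)
    then have "\<not> Z \<subseteq> A" using Z(3) by blast
    have "X \<subseteq> A" using xa X A(2) A' by (simp add: manifold_order_simps)
    then have "X \<subseteq> Z" using Z(2) by blast
    then show ?thesis
      using X A(2) A' Z(1) \<open>\<not> Z \<subseteq> A\<close> by (intro bexI[OF _ vertex_set_in_manifold[OF Z(1)]])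
        (simp add: manifold_order_simps)
  next
    case X: (2 X)
    note X' = boundary_face_in_complex[OF X(1)]
    have "X \<subset> A" using X(2) A(2) xa X' A' by (simp add: manifold_order_simps)
    then obtain Z where Z: "Z \<in> boundary_faces \<Sigma>" "X \<subseteq> Z" "\<not> Z \<subseteq> A"
      using boundary_face_branched[OF X' A(1)] by blast
    show ?thesis
      using X(2) A(2) X' A' Z(2,3) boundary_face_in_complex[OF Z(1)]
      by (intro bexI[OF _ infinity_in_manifold[OF Z(1)]])
        (simp add: manifold_order_simps subset_insertI2)
  qed
qed

lemma locally_branched_manifold: "locally_branched (insert UNIV M)"
  unfolding locally_branched_def
proof (intro ballI impI)
  fix x a t assume "x \<in> insert UNIV M" "a \<in> insert UNIV M" and t: "t \<in> insert UNIV M"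
    and xa: "x \<subset> a" and at: "a \<subset> t"
  then have "x \<in> M" "a \<in> M" by auto
  have "\<exists>z\<in>M. x \<subseteq> z \<and> z \<subset> t \<and> \<not> z \<subseteq> a"
  proof (cases "t = UNIV")
    case True
    then show ?thesis
      using branched_at_top[OF \<open>x \<in> M\<close> \<open>a \<in> M\<close> xa] psubset_UNIV by blast
  next
    case False
    then have "t \<in> M" using t by auto
    then show ?thesis
    proof (cases rule: manifold_cases)
      case (1 T)
      then show ?thesis
        using branched_under_cell[OF \<open>x \<in> M\<close> \<open>a \<in> M\<close> _ xa] at by blast
    next
      case (2 H)
      then show ?thesis
        using branched_under_infinity[OF \<open>x \<in> M\<close> \<open>a \<in> M\<close> _ xa] at by blast
    qed
  qed
  then show "\<exists>z\<in>insert UNIV M. x \<subseteq> z \<and> z \<subset> t \<and> \<not> z \<subseteq> a" by blast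
qed

section \<open>Running the iterator on the manifold\<close>

lemma manifold_visits_exactly_once:
  assumes "arranges arr" and C: "set C = avoiding (coatoms M) (set I)"
  shows "visits_exactly_once arr C I J {x \<in> avoiding M (set I). x \<inter> J = {}}"
proof -
  have below_top: "below (insert UNIV M) UNIV = M"
    using psubset_UNIV by blast
  have "finite (insert UNIV M)"
    using finite_manifold by simp
  moreover have "x \<inter> y \<in> insert UNIV M" if "x \<in> insert UNIV M" "y \<in> insert UNIV M" for x y
    using that Int_in_manifold[of x y] by (elim insertE) simp_all
  ultimately show ?thesis
    using face_iterator_visits_exactly_once[of "insert UNIV M" arr UNIV C I J,
        OF _ _ locally_branched_manifold assms(1)] C
    unfolding below_top by simp
qed

lemma vertex_set_Int_Some: "vertex_set F \<inter> Some ` V = {} \<longleftrightarrow> vertices_of F \<inter> V = {}"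
  by (auto simp: vertex_set_def)

text \<open>A coatom above \<open>x\<close> contains \<open>None\<close> too, so it is not the
  vertex set of a cell.\<close>

lemma in_outer_facet:
  assumes "x \<in> M" "None \<in> x"
  obtains y where "y \<in> outer_facets \<Sigma>" "x \<subseteq> y"
proof -
  obtain c where "c \<in> coatoms M" "x \<subseteq> c"
    using coatom_above[OF finite_manifold \<open>x \<in> M\<close>] by blast
  then show ?thesis
    using that[of c] \<open>None \<in> x\<close> None_notin_vertex_set unfolding outer_facets_def by blast
qed

lemma manifold_without_infinity: "{x \<in> M. None \<notin> x} = vertex_set ` \<Sigma>"
  using None_notin_vertex_set by (auto simp: closed_manifold_def)

lemma faces_avoiding_infinity:
  "{x \<in> avoiding M {}. x \<inter> insert None (Some ` V) = {}} =
    vertex_set ` {F \<in> \<Sigma>. vertices_of F \<inter> V = {}}"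
proof -
  have "{x \<in> avoiding M {}. x \<inter> insert None (Some ` V) = {}} =
      {x \<in> {x \<in> M. None \<notin> x}. x \<inter> Some ` V = {}}"
    unfolding avoiding_def by blast
  also have "\<dots> = vertex_set ` {F \<in> \<Sigma>. vertex_set F \<inter> Some ` V = {}}"
    unfolding manifold_without_infinity by blast
  finally show ?thesis unfolding vertex_set_Int_Some .
qed

text \<open>Every face containing \<open>None\<close> lies in an outer facet, so only cells survive.
  The cells dropped along with them are the boundary faces, since an outer facet is the vertex set
  of a boundary face with \<open>None\<close> added.\<close>

lemma faces_avoiding_outer_facets:
  "{x \<in> avoiding M (outer_facets \<Sigma>). x \<inter> Some ` V = {}} =
    vertex_set ` {F \<in> \<Sigma>. vertices_of F \<inter> V = {} \<and>
      (\<forall>y\<in>outer_facets \<Sigma>. \<not> vertex_set F \<subseteq> y)}"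
proof -
  have "None \<notin> x" if "x \<in> M" "\<forall>y\<in>outer_facets \<Sigma>. \<not> x \<subseteq> y" for x
    using that(2) in_outer_facet[OF that(1)] by blast
  then have "{x \<in> avoiding M (outer_facets \<Sigma>). x \<inter> Some ` V = {}} =
      {x \<in> {x \<in> M. None \<notin> x}. x \<inter> Some ` V = {} \<and> (\<forall>y\<in>outer_facets \<Sigma>. \<not> x \<subseteq> y)}"
    unfolding avoiding_def by blast
  also have "\<dots> = vertex_set ` {F \<in> \<Sigma>. vertex_set F \<inter> Some ` V = {} \<and>
      (\<forall>y\<in>outer_facets \<Sigma>. \<not> vertex_set F \<subseteq> y)}"
    unfolding manifold_without_infinity by blast
  finally show ?thesis unfolding vertex_set_Int_Some .
qed

end

text \<open>The conjuncts are two ways of hiding the added faces: the ignored atom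
  \<open>None\<close> hides no cell, whereas the outer facets as ignored sets also hide the boundary
  faces.\<close>

theorem corollary3p11:
  fixes \<Sigma> :: "'a::euclidean_space set set"
    and P V :: "'a set"
    and arr :: "'a option set list \<Rightarrow> 'a option set list"
  assumes "extended_tight_span \<Sigma> P"
    and "V \<subseteq> P"
    and "arranges arr"
  shows
    "(\<forall>C. distinct C \<and> set C = coatoms (closed_manifold \<Sigma>) \<longrightarrow>
        visits_exactly_once arr C [] (insert None (Some ` V))
          (vertex_set ` {F \<in> \<Sigma>. vertices_of F \<inter> V = {}}))
     \<and>
     (\<forall>C I. distinct I \<and> set I = outer_facets \<Sigma> \<and>
        distinct C \<and> set C = {A \<in> coatoms (closed_manifold \<Sigma>). \<forall>y\<in>set I. \<not> A \<subseteq> y} \<longrightarrow>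
        visits_exactly_once arr C I (Some ` V)
          (vertex_set ` {F \<in> \<Sigma>. vertices_of F \<inter> V = {} \<and>
             (\<forall>y\<in>outer_facets \<Sigma>. \<not> vertex_set F \<subseteq> y)}))"
proof -
  interpret tight_span \<Sigma> P
    using assms(1) by unfold_locales
  show ?thesis
  proof (intro conjI allI impI)
    fix C assume C: "distinct C \<and> set C = coatoms M"
    show "visits_exactly_once arr C [] (insert None (Some ` V))
        (vertex_set ` {F \<in> \<Sigma>. vertices_of F \<inter> V = {}})"
      using manifold_visits_exactly_once[OF assms(3), of C "[]" "insert None (Some ` V)"] C
        faces_avoiding_infinity[of V] by (simp add: avoiding_def)
  next
    fix C I
    assume CI: "distinct I \<and> set I = outer_facets \<Sigma> \<and>
      distinct C \<and> set C = {A \<in> coatoms M. \<forall>y\<in>set I. \<not> A \<subseteq> y}"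
    show "visits_exactly_once arr C I (Some ` V)
        (vertex_set ` {F \<in> \<Sigma>. vertices_of F \<inter> V = {} \<and>
          (\<forall>y\<in>outer_facets \<Sigma>. \<not> vertex_set F \<subseteq> y)})"
      using manifold_visits_exactly_once[OF assms(3), of C I "Some ` V"] CI
        faces_avoiding_outer_facets[of V] by (simp add: avoiding_def)
  qed
qed

end
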